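(* Let $p$ be a prime number, let $\lambda,\mu\in\mathbb{F}_p$ with $\lambda\mu\neq 0$, and for a sequence $S=x_1x_2\cdots x_m$ in $\mathbb{F}_p$ let $$\varphi(S)=\Big(\sum_{i=1}^m x_i\Big)^2+\lambda\sum_{i=1}^m x_i^2+\mu\sum_{i=1}^m x_i .$$ Put $\omega_o=-\mu\lambda^{-1}$. If among the extremal $\varphi$-zero free sequences in the set $M(\varphi,p)$ we can find a sequence of the type $S=[\omega_o]^{p-1}[u_1]^{k_1}\cdots[u_t]^{k_t}$, where $\omega_o,u_1,\ldots,u_t$ are distinct elements of $\mathbb{F}_p$ and $k_1,\ldots,k_t$ are positive integers, then $$D(\varphi,p)\le (p-1)+\frac{p-1}{2}.$$
   Context: $\mathbb{F}_p$ is the field with $p$ elements. A sequence in $\mathbb{F}_p$ is a finite list of elements with repetition allowed, where the order is irrelevant (i.e. a finite multiset); its length is its number of terms counted with multiplicity, and a subsequence is a sub-multiset. The notation $[u_1]^{n_1}\cdots[u_t]^{n_t}$ denotes the sequence in which each $u_i$ is repeated $n_i$ times, the $u_i$ being distinct. A sequence $S$ is a $\varphi$-zero sequence if $\varphi(S)=0$ in $\mathbb{F}_p$, and is $\varphi$-zero free if $\varphi(T)\neq 0$ for every nonempty subsequence $T$ of $S$. $D(\varphi,p)$ is the smallest positive integer $\ell$ such that every sequence in $\mathbb{F}_p$ of length at least $\ell$ has a nonempty $\varphi$-zero subsequence. A $\varphi$-zero free sequence is extremal if its length is $D(\varphi,p)-1$, and $M(\varphi,p)$ is the set of all extremal $\varphi$-zero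 free sequences in $\mathbb{F}_p$.
   Formalization: The cases p=2 and p=3 with λ=−1 are excluded: for p=3, λ=−1, μ=1 the sequence [1]^2[2] is extremal with D=4>3, and for p=2 the sequence [1] (t=0) is extremal with D=2>3/2 (with t≥1 no such sequence exists). *)

theory Defs
  imports
    Complex_Main
    "HOL-Library.Multiset"
    "Berlekamp_Zassenhaus.Finite_Field"
begin

text \<open>
  Sequences whose order is irrelevant are multisets, and subsequences are sub-multisets.
  The field with \<open>p\<close> elements is \<open>'p mod_ring\<close> for a type \<open>'p\<close> of prime cardinality \<open>p\<close>.
\<close>

definition phi :: "'p::prime_card mod_ring \<Rightarrow> 'p mod_ring \<Rightarrow> 'p mod_ring multiset \<Rightarrow> 'p mod_ring"
  where "phi lam mu S = (\<Sum>x\<in>#S. x)^2 + lam * (\<Sum>x\<in>#S. x^2) + mu * (\<Sum>x\<in>#S. x)"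

definition zero_sequence :: "('a multiset \<Rightarrow> 'b::zero) \<Rightarrow> 'a multiset \<Rightarrow> bool"
  where "zero_sequence f S \<longleftrightarrow> f S = 0"

definition zero_free :: "('a multiset \<Rightarrow> 'b::zero) \<Rightarrow> 'a multiset \<Rightarrow> bool"
  where "zero_free f S \<longleftrightarrow> (\<forall>T. T \<subseteq># S \<and> T \<noteq> {#} \<longrightarrow> \<not> zero_sequence f T)"

text \<open>
  \<open>D_const (phi lam mu)\<close> is \<open>D(\<phi>,p)\<close>. The minimum exists for \<open>f = phi lam mu\<close>: see
  \<open>D_const_phi_exists\<close> below.
\<close>

definition D_const :: "('a multiset \<Rightarrow> 'b::zero) \<Rightarrow> nat"
  where "D_const f =
    (LEAST l. l > 0 \<and> (\<forall>S. size S \<ge> l \<longrightarrow> (\<exists>T. T \<subseteq># S \<and> T \<noteq> {#} \<and> zero_sequence f T)))"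

definition extremal :: "('a multiset \<Rightarrow> 'b::zero) \<Rightarrow> 'a multiset \<Rightarrow> bool"
  where "extremal f S \<longleftrightarrow> zero_free f S \<and> size S = D_const f - 1"

definition M_set :: "('a multiset \<Rightarrow> 'b::zero) \<Rightarrow> 'a multiset set"
  where "M_set f = {S. extremal f S}"

lemma D_const_phi_exists:
  fixes lam mu :: "'p::prime_card mod_ring"
  shows "\<exists>l>0. \<forall>S. size S \<ge> l \<longrightarrow> (\<exists>T. T \<subseteq># S \<and> T \<noteq> {#} \<and> zero_sequence (phi lam mu) T)"
proof (intro exI[of _ "CARD('p) * CARD('p)"] conjI allI impI)
  show "0 < CARD('p) * CARD('p)" by simp
next
  fix S :: "'p mod_ring multiset"
  assume S: "CARD('p) * CARD('p) \<le> size S"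
  have "\<exists>x. count S x \<ge> CARD('p)"
  proof (rule ccontr)
    assume "\<not> ?thesis"
    then have less: "count S x < CARD('p)" for x by (meson not_le)
    have "size S = (\<Sum>x\<in>UNIV. count S x)"
      unfolding size_multiset_overloaded_eq
      by (rule sum.mono_neutral_left) (auto simp: not_in_iff)
    also have "\<dots> < (\<Sum>x\<in>(UNIV :: 'p mod_ring set). CARD('p))"
      by (rule sum_strict_mono) (auto simp: less)
    also have "\<dots> = CARD('p) * CARD('p)" by simp
    finally show False using S by simp
  qed
  then obtain x where x: "count S x \<ge> CARD('p)" by blast
  have "of_nat CARD('p) = (0 :: 'p mod_ring)" by simp
  then have "zero_sequence (phi lam mu) (replicate_mset CARD('p) x)"
    by (simp add: zero_sequence_def phi_def)
  moreover have "replicate_mset CARD('p) x \<subseteq># S"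
    using x by (simp add: count_le_replicate_mset_subset_eq)
  moreover have "replicate_mset CARD('p) x \<noteq> {#}" by simp
  ultimately show "\<exists>T. T \<subseteq># S \<and> T \<noteq> {#} \<and> zero_sequence (phi lam mu) T" by blast
qed

end

theory Submission
  imports Defs
begin

text \<open>
  Put \<open>f x = \<lambda>x\<^sup>2 + \<mu>x\<close>. Since \<open>f \<omega> = 0\<close>, adjoining \<open>k\<close> copies of \<open>\<omega>\<close> to \<open>T\<close> gives
  \<open>\<phi> = (\<sigma>(T) + k\<omega>)\<^sup>2 + \<Sum>\<^sub>T f\<close>, and \<open>\<sigma>(T) + k\<omega>\<close> takes every value as \<open>k\<close> runs over
  \<open>0, \<dots>, p - 1\<close>. Hence every nonempty subsum of the sequence \<open>-f(x)\<close>, where \<open>x\<close> runs over the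
  terms different from \<open>\<omega>\<close>, is a nonsquare. There are only \<open>h = (p-1)/2\<close> nonsquares, whereas
  a zero-sum free sequence has at least as many subsums as terms, and strictly more unless it is
  constant. So the sequence has fewer than \<open>h\<close> terms, or it is \<open>[a]\<^sup>h\<close>. In the latter case
  \<open>a, 2a, \<dots>, ha\<close> are all the nonsquares; but if \<open>h \<ge> 2\<close> then \<open>a/2 = 2a(1/2)\<^sup>2\<close> is another one.
  For \<open>p = 3\<close> the hypothesis \<open>\<lambda> \<noteq> -1\<close> is needed: for \<open>\<lambda> = -1\<close>, \<open>\<mu> = 1\<close> the sequence
  \<open>[1]\<^sup>2[2]\<close> is extremal.
\<close>

section \<open>Subsums of zero-sum free sequences\<close>

definition subsums :: "'a::comm_monoid_add multiset \<Rightarrow> 'a set"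
  where "subsums B = {sum_mset T |T. T \<subseteq># B \<and> T \<noteq> {#}}"

lemma subsumsI: "T \<subseteq># B \<Longrightarrow> T \<noteq> {#} \<Longrightarrow> sum_mset T \<in> subsums B"
  by (auto simp: subsums_def)

lemma subsums_mono: "A \<subseteq># B \<Longrightarrow> subsums A \<subseteq> subsums B"
  unfolding subsums_def using subset_mset.order_trans by blast

lemma in_subsums: "x \<in># B \<Longrightarrow> x \<in> subsums B"
  using subsumsI[of "{#x#}" B] by simp

text \<open>Each adjoined term contributes a new subsum, namely the sum of everything so far: if
  some \<open>T\<close> avoiding one copy of the new term had that same sum, its complement would be
  a nonempty zero-sum sub-multiset.\<close>

lemma card_subsums_union:
  fixes C D :: "'a::{ab_group_add,finite} multiset"
  assumes "0 \<notin> subsums (C + D)"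
  shows "card (subsums C) + size D \<le> card (subsums (C + D))"
  using assms
proof (induction D)
  case (add x D)
  define E where "E = C + add_mset x D"
  have sub: "subsums (C + D) \<subseteq> subsums E"
    by (rule subsums_mono) (simp add: E_def)
  have "sum_mset E \<notin> subsums (C + D)"
  proof
    assume "sum_mset E \<in> subsums (C + D)"
    then obtain T where T: "T \<subseteq># C + D" "sum_mset T = sum_mset E"
      by (auto simp: subsums_def)
    have "T \<subseteq># E"
      using T(1) subset_mset.order_trans by (fastforce simp: E_def)
    then have TE: "T + (E - T) = E"
      by (rule subset_mset.add_diff_inverse)
    have "size T < size E"
      using size_mset_mono[OF T(1)] by (simp add: E_def)
    then have "E - T \<noteq> {#}"
      using TE by auto
    moreover have "sum_mset (E - T) = 0"
      using T(2) TE by (metis add_cancel_left_right sum_mset.union)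
    ultimately show False
      using add.prems subsumsI[of "E - T" E] by (simp add: E_def)
  qed
  moreover have "sum_mset E \<in> subsums E"
    by (rule subsumsI) (auto simp: E_def)
  ultimately have "card (subsums (C + D)) < card (subsums E)"
    using sub by (intro psubset_card_mono) auto
  moreover have "card (subsums C) + size D \<le> card (subsums (C + D))"
    using add sub by (auto simp: E_def)
  ultimately show ?case
    by (simp add: E_def)
qed simp

lemma size_le_card_subsums:
  fixes B :: "'a::{ab_group_add,finite} multiset"
  assumes "0 \<notin> subsums B"
  shows "size B \<le> card (subsums B)"
  using card_subsums_union[of "{#}" B] assms by simp

text \<open>Distinct terms \<open>x\<close>, \<open>y\<close> already give three subsums
  \<open>x\<close>, \<open>y\<close>, \<open>x + y\<close>, and by \<open>card_subsums_union\<close>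
  every further term adds at least one, so the subsums outnumber the terms.\<close>

lemma subsums_minimal_imp_constant:
  fixes B :: "'a::{ab_group_add,finite} multiset"
  assumes "0 \<notin> subsums B" and "card (subsums B) \<le> size B"
  shows "\<exists>a. B = replicate_mset (size B) a"
proof -
  have eq: "x = y" if x: "x \<in># B" and y: "y \<in># B" for x y
  proof (rule ccontr)
    assume "x \<noteq> y"
    have "{#x, y#} \<subseteq># B"
      using x y \<open>x \<noteq> y\<close> by (simp add: insert_subset_eq_iff in_diff_count)
    then obtain D where D: "B = {#x, y#} + D"
      by (auto simp: subset_mset.le_iff_add)
    have "x \<noteq> 0" "y \<noteq> 0"
      using in_subsums x y assms(1) by metis+
    then have "card {x, y, x + y} = 3"
      using \<open>x \<noteq> y\<close> by auto
    moreover have "{x, y, x + y} \<subseteq> subsums {#x, y#}"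
      using subsumsI[of "{#x, y#}" "{#x, y#}"] by (auto intro: in_subsums)
    ultimately have "3 \<le> card (subsums {#x, y#})"
      using card_mono[OF finite] by metis
    then show False
      using card_subsums_union[of "{#x, y#}" D] assms unfolding D by simp
  qed
  show ?thesis
  proof (cases "B = {#}")
    case False
    then obtain a where "a \<in># B"
      by auto
    then have "B = replicate_mset (size B) a"
      using eq by (intro set_mset_subset_singletonD) blast
    then show ?thesis ..
  qed simp
qed

section \<open>Nonsquares modulo a prime\<close>

lemma of_nat_mod_ring_neq_0:
  assumes "0 < n" and "n < CARD('p)"
  shows "(of_nat n :: 'p::prime_card mod_ring) \<noteq> 0"
  using of_nat_0_mod_ring_dvd[of n, where 'a = 'p] assms nat_dvd_not_less by blast

lemma odd_CARD_prime_card: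
  assumes "CARD('p::prime_card) \<noteq> 2"
  shows "odd CARD('p)"
  using prime_card[where 'a = 'p] assms prime_odd_nat prime_ge_2_nat
  by (metis le_neq_implies_less)

text \<open>The squares of 0, ..., \<open>h\<close> are distinct: for \<open>i < j \<le> h\<close>,
  both \<open>j - i\<close> and \<open>j + i\<close> lie strictly between 0 and \<open>p\<close>, so
  their product is nonzero modulo \<open>p\<close>. This gives \<open>h + 1\<close> squares, 0
  included.\<close>

lemma card_nonsquares_le:
  assumes "CARD('p::prime_card) \<noteq> 2"
  shows "card (- range (\<lambda>x :: 'p mod_ring. x^2)) \<le> (CARD('p) - 1) div 2"
proof -
  define h where "h = (CARD('p) - 1) div 2"
  have h: "CARD('p) = 2 * h + 1"
    using odd_CARD_prime_card[OF assms] by (auto simp: h_def elim: oddE)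
  have neq: "(of_nat i :: 'p mod_ring)^2 \<noteq> of_nat j ^ 2" if "i < j" "j \<le> h" for i j
  proof
    assume "(of_nat i :: 'p mod_ring)^2 = of_nat j ^ 2"
    then have "of_nat (j - i) * (of_nat (j + i) :: 'p mod_ring) = 0"
      using that by (simp add: of_nat_diff algebra_simps power2_eq_square)
    then have "of_nat (j - i) = (0 :: 'p mod_ring) \<or> of_nat (j + i) = (0 :: 'p mod_ring)"
      by (simp only: mult_eq_0_iff)
    then show False
      using of_nat_mod_ring_neq_0[of "j - i", where 'p = 'p]
        of_nat_mod_ring_neq_0[of "j + i", where 'p = 'p] that h by auto
  qed
  have "inj_on (\<lambda>i. (of_nat i :: 'p mod_ring)^2) {..h}"
  proof (rule inj_onI)
    fix i j
    assume "i \<in> {..h}" "j \<in> {..h}" "(of_nat i :: 'p mod_ring)^2 = of_nat j ^ 2"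
    then show "i = j"
      using neq[of i j] neq[of j i] by (cases i j rule: linorder_cases) auto
  qed
  then have "h + 1 = card ((\<lambda>i. (of_nat i :: 'p mod_ring)^2) ` {..h})"
    by (simp add: card_image)
  also have "\<dots> \<le> card (range (\<lambda>x :: 'p mod_ring. x^2))"
    by (intro card_mono) auto
  finally show ?thesis
    using h by (simp add: Compl_eq_Diff_UNIV card_Diff_subset flip: h_def)
qed

lemma size_less_if_subsums_nonsquare:
  fixes B :: "'p::prime_card mod_ring multiset"
  assumes "CARD('p) \<noteq> 2" and "CARD('p) \<noteq> 3"
    and ns: "subsums B \<inter> range (\<lambda>x. x^2) = {}"
  shows "size B < (CARD('p) - 1) div 2"
proof (rule ccontr)
  define h where "h = (CARD('p) - 1) div 2"
  assume "\<not> ?thesis"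
  then have size_ge: "h \<le> size B"
    by (simp add: h_def)
  have h: "CARD('p) = 2 * h + 1"
    using odd_CARD_prime_card[OF assms(1)] by (auto simp: h_def elim: oddE)
  have "h \<noteq> 0" "h \<noteq> 1"
    using h prime_gt_1_nat[OF prime_card[where 'a = 'p]] assms(2) by auto
  then have "h \<ge> 2"
    by linarith
  \<comment> \<open>Since 0 is a square, \<open>ns\<close> makes \<open>B\<close> zero-sum
    free.\<close>
  have zero: "0 \<notin> subsums B"
    using ns by (auto simp: disjoint_iff image_iff)
  have le_h: "card X \<le> h" if "X \<inter> range (\<lambda>x. x^2) = {}" for X :: "'p mod_ring set"
  proof -
    have "card X \<le> card (- range (\<lambda>x :: 'p mod_ring. x^2))"
      using that by (intro card_mono) auto
    then show ?thesis
      using card_nonsquares_le[OF assms(1)] by (simp add: h_def)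
  qed
  \<comment> \<open>Equality throughout
    \<open>h \<le> size B \<le> card (subsums B) \<le> h\<close>.\<close>
  have size: "size B = h" and card: "card (subsums B) = h"
    using size_ge size_le_card_subsums[OF zero] le_h[OF ns] by auto
  obtain a where a: "B = replicate_mset h a"
    using subsums_minimal_imp_constant[OF zero] size card by auto
  have sums: "\<exists>i\<in>{1..h}. s = of_nat i * a" if "s \<in> subsums B" for s
  proof -
    from that obtain T where T: "T \<subseteq># replicate_mset h a" "T \<noteq> {#}" "s = sum_mset T"
      by (auto simp: subsums_def a)
    then obtain m where m: "m \<le> h" "T = replicate_mset m a"
      by (meson msubseteq_replicate_msetE)
    then have "m \<in> {1..h}" "s = of_nat m * a"
      using T by (auto simp: Suc_le_eq)
    then show ?thesis ..
  qed
  have two: "(2 :: 'p mod_ring) \<noteq> 0"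
    using of_nat_mod_ring_neq_0[of 2, where 'p = 'p] h \<open>h \<ge> 2\<close> by simp
  \<comment> \<open>This is where \<open>h \<ge> 2\<close>, hence \<open>p \<noteq> 3\<close>,
    enters: \<open>B\<close> must contain \<open>a\<close> twice.\<close>
  have "2 * a \<in> subsums B"
    using subsumsI[of "replicate_mset 2 a" B] \<open>h \<ge> 2\<close>
    by (simp add: a replicate_mset_msubseteq_iff)
  then have nsq: "2 * a \<noteq> x^2" for x
    using ns by blast
  have "a \<noteq> 0"
    using nsq[of 0] by auto
  have "a / 2 \<notin> subsums B"
  proof
    assume "a / 2 \<in> subsums B"
    then obtain i where i: "i \<in> {1..h}" "a / 2 = of_nat i * a"
      using sums by blast
    \<comment> \<open>Doubling \<open>a / 2 = i * a\<close> gives this; the factor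
      \<open>2 * i - 1\<close> is odd and at most \<open>2 * h - 1 < p\<close>, so it cannot
      vanish.\<close>
    then have "of_nat (2 * i - 1) * a = 0"
      using two by (simp add: of_nat_diff field_simps)
    then have "of_nat (2 * i - 1) = (0 :: 'p mod_ring)"
      using \<open>a \<noteq> 0\<close> by (simp only: mult_eq_0_iff simp_thms)
    moreover have "0 < 2 * i - 1" "2 * i - 1 < CARD('p)"
      using i(1) h by auto
    ultimately show False
      using of_nat_mod_ring_neq_0 by blast
  qed
  moreover have "a / 2 \<noteq> x^2" for x
    using nsq[of "2 * x"] two by (auto simp: field_simps power2_eq_square)
  then have "card (insert (a / 2) (subsums B)) \<le> h"
    using ns by (intro le_h) auto
  ultimately show False
    using card by simp
qed

section \<open>Zero-free sequences for \<open>\<phi>\<close>\<close>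

lemma phi_union_replicate_mset:
  fixes lam mu w :: "'p::prime_card mod_ring"
  assumes "lam * w + mu = 0"
  shows "phi lam mu (T + replicate_mset k w)
    = (sum_mset T + of_nat k * w)^2 + (\<Sum>x\<in>#T. lam * x^2 + mu * x)"
proof -
  have mu: "mu = - (lam * w)"
    using assms by (simp add: eq_neg_iff_add_eq_0 add.commute)
  have "(\<Sum>x\<in>#T. lam * x^2 + mu * x) = lam * (\<Sum>x\<in>#T. x^2) + mu * sum_mset T"
    by (induction T) (simp_all add: algebra_simps)
  then show ?thesis
    by (simp add: phi_def mu algebra_simps power2_eq_square)
qed

lemma subsums_nonsquare_if_zero_free:
  fixes lam mu w :: "'p::prime_card mod_ring"
  assumes "lam * w + mu = 0" and "w \<noteq> 0"
    and zf: "zero_free (phi lam mu) (replicate_mset (CARD('p) - 1) w + R)"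
  shows "subsums (image_mset (\<lambda>x. - (lam * x^2 + mu * x)) R) \<inter> range (\<lambda>x. x^2) = {}"
proof -
  have False if U: "U \<subseteq># image_mset (\<lambda>x. - (lam * x^2 + mu * x)) R" "U \<noteq> {#}"
    and y: "sum_mset U = y^2" for U y
  proof -
    obtain T where T: "T \<subseteq># R" "U = image_mset (\<lambda>x. - (lam * x^2 + mu * x)) T"
      using U(1) image_mset_eq_plusD[of _ R U] mset_subset_eq_add_left
      unfolding subset_mset.le_iff_add by blast
    \<comment> \<open>This \<open>k\<close> shifts the sum of \<open>T\<close> to exactly
      \<open>y\<close>, and the \<open>p - 1\<close> available copies of \<open>w\<close>
      suffice.\<close>
    obtain k where k: "k < CARD('p)" "(y - sum_mset T) / w = of_nat k"
      using surj_of_nat_mod_ring by blast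
    have "sum_mset T + of_nat k * w = y"
      using \<open>w \<noteq> 0\<close> by (simp flip: k(2))
    moreover have "(\<Sum>x\<in>#T. lam * x^2 + mu * x) = - (y^2)"
      unfolding y[symmetric] T(2) by (induction T) auto
    ultimately have "phi lam mu (T + replicate_mset k w) = 0"
      using phi_union_replicate_mset[OF assms(1)] by simp
    moreover have "T + replicate_mset k w \<subseteq># replicate_mset (CARD('p) - 1) w + R"
      using T(1) k(1)
      by (subst add.commute) (intro subset_mset.add_mono, auto simp: replicate_mset_msubseteq_iff)
    moreover have "T + replicate_mset k w \<noteq> {#}"
      using U(2) T(2) by auto
    ultimately show False
      using zf by (auto simp: zero_free_def zero_sequence_def)
  qed
  then show ?thesis
    unfolding subsums_def by blast
qed

lemma mod_ring_3_cases:
  fixes x :: "'p::prime_card mod_ring"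
  assumes "CARD('p) = 3"
  shows "x = 0 \<or> x = 1 \<or> x = - 1"
proof -
  obtain i where i: "i < 3" "x = of_nat i"
    using surj_of_nat_mod_ring[of x] assms by auto
  have "(3 :: 'p mod_ring) = 0"
    using of_nat_card_eq_0[where 'a = 'p] assms by simp
  then have "(2 :: 'p mod_ring) = - 1"
    by (simp add: eq_neg_iff_add_eq_0)
  moreover have "i = 0 \<or> i = 1 \<or> i = 2"
    using i(1) by auto
  ultimately show ?thesis
    using i(2) by auto
qed

text \<open>Here \<open>h = 1\<close>, so not even one term is allowed. With \<open>lam = 1\<close>,
  and -1 the only nonsquare, a term \<open>x\<close> satisfies \<open>x^2 + mu * x = 1\<close>; as
  \<open>x \<noteq> 0\<close> forces \<open>x^2 = 1\<close>, this yields
  \<open>mu * x = 0\<close>.\<close>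

lemma no_term_if_subsums_nonsquare_3:
  fixes lam mu :: "'p::prime_card mod_ring"
  assumes card: "CARD('p) = 3" and "lam * mu \<noteq> 0" and "lam \<noteq> - 1"
    and ns: "subsums (image_mset (\<lambda>x. - (lam * x^2 + mu * x)) R) \<inter> range (\<lambda>x. x^2) = {}"
  shows "R = {#}"
proof (rule ccontr)
  assume "R \<noteq> {#}"
  then obtain x where "x \<in># R"
    by auto
  then have "- (lam * x^2 + mu * x) \<in> subsums (image_mset (\<lambda>x. - (lam * x^2 + mu * x)) R)"
    by (intro in_subsums) auto
  then have nsq: "- (lam * x^2 + mu * x) \<noteq> y^2" for y
    using ns by blast
  have "lam = 1"
    using mod_ring_3_cases[OF card, of lam] assms(2,3) by auto
  moreover have "x \<noteq> 0"
    using nsq[of 0] by auto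
  then have "x^2 = 1"
    using mod_ring_3_cases[OF card, of x] by auto
  moreover have "lam * x^2 + mu * x = 1"
    using mod_ring_3_cases[OF card, of "lam * x^2 + mu * x"] nsq[of 0] nsq[of 1]
    by (metis minus_minus minus_zero one_power2 zero_power2)
  ultimately show False
    using \<open>x \<noteq> 0\<close> assms(2) by simp
qed

text \<open>The case \<open>p = 2\<close> is a true exception: for \<open>lam = mu = 1\<close> the
  sequence [1] is extremal and \<open>D_const\<close> is 2, above the bound 3/2. For odd
  \<open>p\<close> the bound equals \<open>3 * h\<close>.\<close>

theorem theorem4p5:
  fixes lam mu omega :: "'p::prime_card mod_ring"
    and S :: "'p mod_ring multiset"
    and t :: nat and u :: "nat \<Rightarrow> 'p mod_ring" and k :: "nat \<Rightarrow> nat"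
  defines "omega \<equiv> - mu * inverse lam"
  assumes "lam * mu \<noteq> 0"
    and "CARD('p) \<noteq> 2"
    and "CARD('p) = 3 \<Longrightarrow> lam \<noteq> - 1"
    and "S \<in> M_set (phi lam mu)"
    and "S = replicate_mset (CARD('p) - 1) omega + (\<Sum>i\<in>{1..t}. replicate_mset (k i) (u i))"
    and "inj_on u {1..t}"
    and "\<And>i. i \<in> {1..t} \<Longrightarrow> u i \<noteq> omega"
    and "\<And>i. i \<in> {1..t} \<Longrightarrow> k i > 0"
  shows "real (D_const (phi lam mu)) \<le> (real CARD('p) - 1) + (real CARD('p) - 1) / 2"
proof -
  define R where "R = (\<Sum>i\<in>{1..t}. replicate_mset (k i) (u i))"
  define h where "h = (CARD('p) - 1) div 2"
  have h: "CARD('p) = 2 * h + 1"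
    using odd_CARD_prime_card[OF assms(3)] by (auto simp: h_def elim: oddE)
  have "h \<ge> 1"
    using h prime_gt_1_nat[OF prime_card[where 'a = 'p]] by linarith
  have omega: "lam * omega + mu = 0" "omega \<noteq> 0"
    using assms(2) by (auto simp: omega_def)
  have "zero_free (phi lam mu) S" and D: "size S = D_const (phi lam mu) - 1"
    using assms(5) by (auto simp: M_set_def extremal_def)
  then have ns: "subsums (image_mset (\<lambda>x. - (lam * x^2 + mu * x)) R) \<inter> range (\<lambda>x. x^2) = {}"
    using subsums_nonsquare_if_zero_free[OF omega] assms(6) by (simp add: R_def)
  have "size R < h"
  proof (cases "CARD('p) = 3")
    case True
    then have "R = {#}"
      using no_term_if_subsums_nonsquare_3 assms(2,4) ns by blast
    then show ?thesis
      using \<open>h \<ge> 1\<close> by simp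
  next
    case False
    then show ?thesis
      using size_less_if_subsums_nonsquare[OF assms(3) _ ns] by (simp add: h_def)
  qed
  moreover have "size S = 2 * h + size R"
    using assms(6) h by (simp add: R_def)
  \<comment> \<open>The strict inequality \<open>size R < h\<close> absorbs the 1 in
    \<open>size S = D_const (phi lam mu) - 1\<close>.\<close>
  ultimately have "D_const (phi lam mu) \<le> 3 * h"
    using D by linarith
  then have "real (D_const (phi lam mu)) \<le> 3 * real h"
    by linarith
  then show ?thesis
    using h by simp
qed

end
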